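(* Let $P\in\mathbb{R}_+^{m\times n}$ be a probability matrix, let $k\le\min\{m,n\}$ be a positive integer, and consider the objective function $D:(Q_-,Q_+)\mapsto D(P||Q_-Q_+)$ and the algorithm $$Q_-^{t+1}(il)=Q_-^t(il)\sum_j\frac{Q_+^t(lj)P(ij)}{(Q_-^tQ_+^t)(ij)},$$ $$Q_+^{t+1}(lj)=Q_+^t(lj)\sum_i\frac{Q_-^t(il)P(ij)}{(Q_-^tQ_+^t)(ij)}\Big/\sum_{ij}\frac{Q_-^t(il)Q_+^t(lj)P(ij)}{(Q_-^tQ_+^t)(ij)},$$ started from an admissible initial value $(Q_-^0,Q_+^0)$. (1) If $(Q_-,Q_+)$ is a limit point of the algorithm in the interior of the domain, then it is a stationary point of the objective function $D$, i.e. all partial derivatives $\frac{\partial D}{\partial Q_-(il)}$ and $\frac{\partial D}{\partial Q_+(lj)}$ vanish at $(Q_-,Q_+)$. (2) If $(Q_-,Q_+)$ is a limit point of the algorithm on the boundary of the domain corresponding to an approximate factorization where none of the columns of $Q_-$ is zero (i.e. $\sum_iQ_-(il)>0$ for all $l$), then all partial derivatives $\frac{\partial D}{\partial Q_-(il)}$ and $\frac{\partial D}{\partial Q_+(lj)}$ at $(Q_-,Q_+)$ are nonnegative.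
   Context: $\mathbb{R}_+=[0,\infty)$. A probability matrix is a matrix $P$ with $P(ij)\ge 0$ and $\sum_{ij}P(ij)=1$. For nonnegative numbers $p,q$ the I-divergence is $D(p||q)=p\log\frac{p}{q}-p+q$, with the conventions $0/0=0$, $0\log0=0$, $p/0=\infty$ for $p>0$. The objective function is $$D(P||Q_-Q_+)=\sum_{ij}D\big(P(ij)||(Q_-Q_+)(ij)\big),$$ viewed as a function of all entries of $Q_-\in\mathbb{R}_+^{m\times k}$ and $Q_+\in\mathbb{R}_+^{k\times n}$ (keeping the terms $-P(ij)+(Q_-Q_+)(ij)$), so that, with $0/0=0$, $$\frac{\partial D}{\partial Q_-(il)}=\sum_jQ_+(lj)\Big(1-\frac{P(ij)}{(Q_-Q_+)(ij)}\Big),\qquad \frac{\partial D}{\partial Q_+(lj)}=\sum_iQ_-(il)\Big(1-\frac{P(ij)}{(Q_-Q_+)(ij)}\Big).$$ The domain is the set of pairs $(Q_-,Q_+)$ with nonnegative entries; its interior is the subset of pairs with all entries strictly positive, and its boundary consists of the pairs having at least one entry equal to zero. An admissible initial value is a pair $(Q_-^0,Q_+^0)$ in the interior with $\sum_{il}Q_-^0(il)=1$ and $\sum_jQ_+^0(lj)=1$ for all $l$. A limit point of the algorithm is a pair $(Q_-,Q_+)$ which is the limit, as $t\to\infty$, of the sequence $(Q_-^t,Q_+^t)$ generated from some admissible initial value. *)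

theory Defs
  imports "HOL-Analysis.Analysis"
begin

text \<open>The sizes m, n, k are the cardinalities of the finite index types 'm, 'n, 'k.
  A pair (Qm, Qp) stands for $(Q_-, Q_+)$.\<close>

type_synonym ('m, 'n, 'k) fpair = "(real ^ 'k ^ 'm) \<times> (real ^ 'n ^ 'k)"

definition prob_matrix :: "real ^ 'n::finite ^ 'm::finite \<Rightarrow> bool" where
  "prob_matrix P \<longleftrightarrow> (\<forall>i j. 0 \<le> P $ i $ j) \<and> (\<Sum>i\<in>UNIV. \<Sum>j\<in>UNIV. P $ i $ j) = 1"

definition I_div :: "real \<Rightarrow> real \<Rightarrow> ereal" where
  "I_div p q = (if p = 0 then ereal q
                else if q = 0 then \<infinity>
                else ereal (p * ln (p / q) - p + q))"

definition objective ::
  "real ^ 'n::finite ^ 'm::finite \<Rightarrow> ('m, 'n, 'k::finite) fpair \<Rightarrow> ereal" where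
  "objective P = (\<lambda>(Qm, Qp). \<Sum>i\<in>UNIV. \<Sum>j\<in>UNIV. I_div (P $ i $ j) ((Qm ** Qp) $ i $ j))"

definition set_entry :: "'a ^ 'n::finite ^ 'm::finite \<Rightarrow> 'm \<Rightarrow> 'n \<Rightarrow> 'a \<Rightarrow> 'a ^ 'n ^ 'm" where
  "set_entry A i j x = (\<chi> a b. if a = i \<and> b = j then x else A $ a $ b)"

text \<open>A single entry ranges over $[0,\infty)$. The derivative is therefore taken relative to
  that half-line: it is the ordinary derivative at a positive entry and the right derivative
  at a zero entry. The value at the point itself has to be finite, since \<^const>\<open>real_of_ereal\<close>
  is meaningless at infinity.\<close>

definition has_entry_derivative :: "(real \<Rightarrow> ereal) \<Rightarrow> real \<Rightarrow> real \<Rightarrow> bool" where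
  "has_entry_derivative F d x \<longleftrightarrow>
     \<bar>F x\<bar> \<noteq> \<infinity> \<and> ((\<lambda>s. real_of_ereal (F s)) has_real_derivative d) (at x within {0..})"

definition has_partial_minus ::
  "real ^ 'n::finite ^ 'm::finite \<Rightarrow> ('m, 'n, 'k::finite) fpair \<Rightarrow> 'm \<Rightarrow> 'k \<Rightarrow> real \<Rightarrow> bool" where
  "has_partial_minus P = (\<lambda>(Qm, Qp) i l d.
     has_entry_derivative (\<lambda>s. objective P (set_entry Qm i l s, Qp)) d (Qm $ i $ l))"

definition has_partial_plus ::
  "real ^ 'n::finite ^ 'm::finite \<Rightarrow> ('m, 'n, 'k::finite) fpair \<Rightarrow> 'k \<Rightarrow> 'n \<Rightarrow> real \<Rightarrow> bool" where
  "has_partial_plus P = (\<lambda>(Qm, Qp) l j d.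
     has_entry_derivative (\<lambda>s. objective P (Qm, set_entry Qp l j s)) d (Qp $ l $ j))"

definition stationary_point ::
  "real ^ 'n::finite ^ 'm::finite \<Rightarrow> ('m, 'n, 'k::finite) fpair \<Rightarrow> bool" where
  "stationary_point P Q \<longleftrightarrow>
     (\<forall>i l. has_partial_minus P Q i l 0) \<and> (\<forall>l j. has_partial_plus P Q l j 0)"

definition partials_nonneg ::
  "real ^ 'n::finite ^ 'm::finite \<Rightarrow> ('m, 'n, 'k::finite) fpair \<Rightarrow> bool" where
  "partials_nonneg P Q \<longleftrightarrow>
     (\<forall>i l. \<exists>d\<ge>0. has_partial_minus P Q i l d) \<and> (\<forall>l j. \<exists>d\<ge>0. has_partial_plus P Q l j d)"

definition nn_domain :: "('m::finite, 'n::finite, 'k::finite) fpair set" where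
  "nn_domain = {(Qm, Qp). (\<forall>i l. 0 \<le> Qm $ i $ l) \<and> (\<forall>l j. 0 \<le> Qp $ l $ j)}"

definition domain_interior :: "('m::finite, 'n::finite, 'k::finite) fpair set" where
  "domain_interior = {(Qm, Qp). (\<forall>i l. 0 < Qm $ i $ l) \<and> (\<forall>l j. 0 < Qp $ l $ j)}"

definition domain_boundary :: "('m::finite, 'n::finite, 'k::finite) fpair set" where
  "domain_boundary =
     {(Qm, Qp) \<in> nn_domain. (\<exists>i l. Qm $ i $ l = 0) \<or> (\<exists>l j. Qp $ l $ j = 0)}"

text \<open>The convention 0/0 = 0 is the one of HOL division.\<close>

definition alg_step ::
  "real ^ 'n::finite ^ 'm::finite \<Rightarrow> ('m, 'n, 'k::finite) fpair \<Rightarrow> ('m, 'n, 'k) fpair" where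
  "alg_step P = (\<lambda>(Qm, Qp).
     (\<chi> i l. Qm $ i $ l * (\<Sum>j\<in>UNIV. Qp $ l $ j * P $ i $ j / (Qm ** Qp) $ i $ j),
      \<chi> l j. Qp $ l $ j * (\<Sum>i\<in>UNIV. Qm $ i $ l * P $ i $ j / (Qm ** Qp) $ i $ j)
        / (\<Sum>i\<in>UNIV. \<Sum>j'\<in>UNIV. Qm $ i $ l * Qp $ l $ j' * P $ i $ j' / (Qm ** Qp) $ i $ j')))"

definition admissible_init :: "('m::finite, 'n::finite, 'k::finite) fpair \<Rightarrow> bool" where
  "admissible_init = (\<lambda>(Qm, Qp).
     (Qm, Qp) \<in> domain_interior
     \<and> (\<Sum>i\<in>UNIV. \<Sum>l\<in>UNIV. Qm $ i $ l) = 1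
     \<and> (\<forall>l. (\<Sum>j\<in>UNIV. Qp $ l $ j) = 1))"

definition alg_limit_point ::
  "real ^ 'n::finite ^ 'm::finite \<Rightarrow> ('m, 'n, 'k::finite) fpair \<Rightarrow> bool" where
  "alg_limit_point P Q \<longleftrightarrow>
     (\<exists>Q0. admissible_init Q0 \<and> (\<lambda>t. (alg_step P ^^ t) Q0) \<longlonglongrightarrow> Q)"

text \<open>The partial derivatives have the expected closed form wherever the objective is finite.\<close>

lemma objective_finite_iff:
  "\<bar>objective P (Qm, Qp)\<bar> \<noteq> \<infinity> \<longleftrightarrow> (\<forall>i j. P $ i $ j \<noteq> 0 \<longrightarrow> (Qm ** Qp) $ i $ j \<noteq> 0)"
proof -
  have "\<bar>objective P (Qm, Qp)\<bar> \<noteq> \<infinity> \<longleftrightarrow>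
        (\<forall>i j. \<bar>I_div (P $ i $ j) ((Qm ** Qp) $ i $ j)\<bar> \<noteq> \<infinity>)"
    unfolding objective_def by (auto simp: sum_Inf)
  also have "\<dots> \<longleftrightarrow> (\<forall>i j. P $ i $ j \<noteq> 0 \<longrightarrow> (Qm ** Qp) $ i $ j \<noteq> 0)"
    by (auto simp: I_div_def)
  finally show ?thesis .
qed

lemma objective_real:
  assumes "\<And>i j. P $ i $ j \<noteq> 0 \<Longrightarrow> (Qm ** Qp) $ i $ j \<noteq> 0"
  shows "objective P (Qm, Qp) = ereal (\<Sum>i\<in>UNIV. \<Sum>j\<in>UNIV.
           P $ i $ j * ln (P $ i $ j / (Qm ** Qp) $ i $ j) - P $ i $ j + (Qm ** Qp) $ i $ j)"
proof -
  have "I_div (P $ i $ j) ((Qm ** Qp) $ i $ j) =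
     ereal (P $ i $ j * ln (P $ i $ j / (Qm ** Qp) $ i $ j) - P $ i $ j + (Qm ** Qp) $ i $ j)" for i j
    using assms[of i j] by (auto simp: I_div_def)
  then show ?thesis by (simp add: objective_def)
qed

lemma has_entry_derivative_affine:
  fixes P :: "real ^ 'n::finite ^ 'm::finite"
    and R :: "real \<Rightarrow> ('m, 'n, 'k::finite) fpair"
  assumes R: "\<And>s i j. (fst (R s) ** snd (R s)) $ i $ j = c i j + a i j * (s - x)"
    and P: "\<And>i j. 0 \<le> P $ i $ j" and c: "\<And>i j. 0 \<le> c i j"
    and fin: "\<bar>objective P (R x)\<bar> \<noteq> \<infinity>"
  shows "has_entry_derivative (\<lambda>s. objective P (R s))
           (\<Sum>i\<in>UNIV. \<Sum>j\<in>UNIV. a i j * (1 - P $ i $ j / c i j)) x"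
proof -
  define G where "G s = (\<Sum>i\<in>UNIV. \<Sum>j\<in>UNIV. P $ i $ j * ln (P $ i $ j / (c i j + a i j * (s - x)))
                           - P $ i $ j + (c i j + a i j * (s - x)))" for s
  have pos: "0 < c i j" if "P $ i $ j \<noteq> 0" for i j
  proof -
    have "c i j \<noteq> 0"
      using fin that R[of x i j] by (cases "R x") (auto simp: objective_finite_iff)
    then show ?thesis using c[of i j] by simp
  qed
  have ev1: "\<forall>\<^sub>F s in nhds x. P $ i $ j \<noteq> 0 \<longrightarrow> 0 < c i j + a i j * (s - x)" for i j
  proof (cases "P $ i $ j = 0")
    case False
    have "((\<lambda>s. c i j + a i j * (s - x)) \<longlongrightarrow> c i j + a i j * (x - x)) (nhds x)"
      by (intro tendsto_intros filterlim_ident)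
    then have "\<forall>\<^sub>F s in nhds x. 0 < c i j + a i j * (s - x)"
      using pos[OF False] by (intro order_tendstoD(1)) auto
    then show ?thesis by (rule eventually_mono) simp
  qed simp
  have "\<forall>\<^sub>F s in nhds x. \<forall>i j. P $ i $ j \<noteq> 0 \<longrightarrow> 0 < c i j + a i j * (s - x)"
    by (intro eventually_all_finite ev1)
  then have ev: "\<forall>\<^sub>F s in nhds x. real_of_ereal (objective P (R s)) = G s"
  proof (rule eventually_mono)
    fix s assume s: "\<forall>i j. P $ i $ j \<noteq> 0 \<longrightarrow> 0 < c i j + a i j * (s - x)"
    obtain Qm Qp where Q: "R s = (Qm, Qp)" by force
    have e: "(Qm ** Qp) $ i $ j = c i j + a i j * (s - x)" for i j
      using R[of s i j] Q by simp
    have "objective P (Qm, Qp) = ereal (G s)"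
      by (subst objective_real) (use s in \<open>auto simp: e G_def less_imp_neq[symmetric]\<close>)
    then show "real_of_ereal (objective P (R s)) = G s" using Q by simp
  qed
  have deriv_term: "((\<lambda>s. P $ i $ j * ln (P $ i $ j / (c i j + a i j * (s - x)))
                - P $ i $ j + (c i j + a i j * (s - x)))
           has_real_derivative a i j * (1 - P $ i $ j / c i j)) (at x)" for i j
  proof (cases "P $ i $ j = 0")
    case True
    then show ?thesis by (auto intro!: derivative_eq_intros)
  next
    case False
    then have "0 < P $ i $ j" "0 < c i j" using P[of i j] pos by auto
    then show ?thesis
      by (auto intro!: derivative_eq_intros simp: field_simps)
  qed
  have "(G has_real_derivative (\<Sum>i\<in>UNIV. \<Sum>j\<in>UNIV. a i j * (1 - P $ i $ j / c i j))) (at x)"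
    unfolding G_def by (intro DERIV_sum deriv_term)
  then have "((\<lambda>s. real_of_ereal (objective P (R s))) has_real_derivative
      (\<Sum>i\<in>UNIV. \<Sum>j\<in>UNIV. a i j * (1 - P $ i $ j / c i j))) (at x)"
    using DERIV_cong_ev[OF refl ev refl] by simp
  then show ?thesis
    using fin unfolding has_entry_derivative_def by (auto intro: DERIV_subset)
qed

lemma has_partial_minus_formula:
  fixes P :: "real ^ 'n::finite ^ 'm::finite" and Qm :: "real ^ 'k::finite ^ 'm"
  assumes P: "\<And>i j. 0 \<le> P $ i $ j" and Q: "(Qm, Qp) \<in> nn_domain"
    and fin: "\<bar>objective P (Qm, Qp)\<bar> \<noteq> \<infinity>"
  shows "has_partial_minus P (Qm, Qp) i l
           (\<Sum>j\<in>UNIV. Qp $ l $ j * (1 - P $ i $ j / (Qm ** Qp) $ i $ j))"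
proof -
  define a where "a i' j = (if i' = i then Qp $ l $ j else 0)" for i' j
  have self: "set_entry Qm i l (Qm $ i $ l) = Qm"
    by (simp add: set_entry_def vec_eq_iff)
  have nonneg: "0 \<le> (Qm ** Qp) $ i $ j" for i j
    using Q by (auto simp: nn_domain_def matrix_matrix_mult_def intro!: sum_nonneg)
  have prd: "(set_entry Qm i l s ** Qp) $ i' $ j = (Qm ** Qp) $ i' $ j + a i' j * (s - Qm $ i $ l)" for s i' j
  proof -
    have "(set_entry Qm i l s ** Qp) $ i' $ j =
      (\<Sum>b\<in>UNIV. Qm $ i' $ b * Qp $ b $ j + (if b = l then a i' j * (s - Qm $ i $ l) else 0))"
      unfolding matrix_matrix_mult_def set_entry_def a_def
      by (auto intro!: sum.cong simp: algebra_simps)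
    then show ?thesis
      by (simp add: sum.distrib matrix_matrix_mult_def)
  qed
  have "has_entry_derivative (\<lambda>s. objective P (set_entry Qm i l s, Qp))
     (\<Sum>i'\<in>UNIV. \<Sum>j\<in>UNIV. a i' j * (1 - P $ i' $ j / (Qm ** Qp) $ i' $ j)) (Qm $ i $ l)"
    using Q P fin
    by (intro has_entry_derivative_affine[where R = "\<lambda>s. (set_entry Qm i l s, Qp)"])
       (auto simp: prd self nonneg)
  also have "(\<Sum>i'\<in>UNIV. \<Sum>j\<in>UNIV. a i' j * (1 - P $ i' $ j / (Qm ** Qp) $ i' $ j)) =
     (\<Sum>i'\<in>UNIV. if i' = i then \<Sum>j\<in>UNIV. Qp $ l $ j * (1 - P $ i $ j / (Qm ** Qp) $ i $ j) else 0)"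
    by (intro sum.cong) (auto simp: a_def)
  finally show ?thesis by (simp add: has_partial_minus_def)
qed

lemma has_partial_plus_formula:
  fixes P :: "real ^ 'n::finite ^ 'm::finite" and Qm :: "real ^ 'k::finite ^ 'm"
  assumes P: "\<And>i j. 0 \<le> P $ i $ j" and Q: "(Qm, Qp) \<in> nn_domain"
    and fin: "\<bar>objective P (Qm, Qp)\<bar> \<noteq> \<infinity>"
  shows "has_partial_plus P (Qm, Qp) l j
           (\<Sum>i\<in>UNIV. Qm $ i $ l * (1 - P $ i $ j / (Qm ** Qp) $ i $ j))"
proof -
  define a where "a i j' = (if j' = j then Qm $ i $ l else 0)" for i j'
  have self: "set_entry Qp l j (Qp $ l $ j) = Qp"
    by (simp add: set_entry_def vec_eq_iff)
  have nonneg: "0 \<le> (Qm ** Qp) $ i $ j" for i j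
    using Q by (auto simp: nn_domain_def matrix_matrix_mult_def intro!: sum_nonneg)
  have prd: "(Qm ** set_entry Qp l j s) $ i $ j' = (Qm ** Qp) $ i $ j' + a i j' * (s - Qp $ l $ j)" for s i j'
  proof -
    have "(Qm ** set_entry Qp l j s) $ i $ j' =
      (\<Sum>b\<in>UNIV. Qm $ i $ b * Qp $ b $ j' + (if b = l then a i j' * (s - Qp $ l $ j) else 0))"
      unfolding matrix_matrix_mult_def set_entry_def a_def
      by (auto intro!: sum.cong simp: algebra_simps)
    then show ?thesis
      by (simp add: sum.distrib matrix_matrix_mult_def)
  qed
  have "has_entry_derivative (\<lambda>s. objective P (Qm, set_entry Qp l j s))
     (\<Sum>i\<in>UNIV. \<Sum>j'\<in>UNIV. a i j' * (1 - P $ i $ j' / (Qm ** Qp) $ i $ j')) (Qp $ l $ j)"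
    using Q P fin
    by (intro has_entry_derivative_affine[where R = "\<lambda>s. (Qm, set_entry Qp l j s)"])
       (auto simp: prd self nonneg)
  also have "(\<Sum>i\<in>UNIV. \<Sum>j'\<in>UNIV. a i j' * (1 - P $ i $ j' / (Qm ** Qp) $ i $ j')) =
     (\<Sum>i\<in>UNIV. \<Sum>j'\<in>UNIV. if j' = j then Qm $ i $ l * (1 - P $ i $ j / (Qm ** Qp) $ i $ j) else 0)"
    by (intro sum.cong) (auto simp: a_def)
  finally show ?thesis by (simp add: has_partial_plus_def)
qed

end

theory Submission
  imports Defs
begin

text \<open>Split the mass \<open>P(ij)\<close> over the hidden index by
  \<open>Y(ilj) = Q\<^sub>-(il) Q\<^sub>+(lj) P(ij) / (Q\<^sub>-Q\<^sub>+)(ij)\<close>. The new \<open>Q\<^sub>-\<close> is a marginal of \<open>Y\<close>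
  and the new \<open>Q\<^sub>+\<close> is a conditional probability of \<open>Y\<close>; both dominate \<open>Y\<close>, so after one step
  \<open>(Q\<^sub>-Q\<^sub>+)(ij) \<ge> \<Sum>\<^sub>l Y(ilj)\<^sup>2 \<ge> P(ij)\<^sup>2/k\<close>. This uniform bound makes the objective finite at
  every limit and the multiplicative factors of the algorithm continuous there. An entry that stays
  positive and converges cannot have a limiting factor above 1, and the sign of
  \<open>1 - factor\<close> is that of the partial derivative.\<close>

section \<open>Scalar sequences with multiplicative updates\<close>

lemma ratio_times_limit:
  fixes x r :: "nat \<Rightarrow> real"
  assumes step: "\<And>t. x (Suc t) = x t * r t" and x: "x \<longlonglongrightarrow> a" and r: "r \<longlonglongrightarrow> \<rho>"
  shows "a * \<rho> = a"
proof -
  have "(\<lambda>t. x (Suc t)) \<longlonglongrightarrow> a * \<rho>" unfolding step by (intro tendsto_mult x r)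
  then show ?thesis using LIMSEQ_unique LIMSEQ_Suc[OF x] by blast
qed

text \<open>A limiting factor above 1 would make the sequence increase from some index on, so its
  limit would be at least a positive term. At a positive limit, however,
  \<open>a * \<rho> = a\<close> forces the factor to be 1.\<close>

lemma convergent_limit_ratio_le_one:
  fixes x r :: "nat \<Rightarrow> real"
  assumes step: "\<And>t. x (Suc t) = x t * r t" and pos: "\<And>t. 0 < x t"
    and x: "x \<longlonglongrightarrow> a" and r: "r \<longlonglongrightarrow> \<rho>"
  shows "\<rho> \<le> 1"
proof (rule ccontr)
  assume "\<not> \<rho> \<le> 1"
  then have "\<forall>\<^sub>F t in sequentially. 1 < r t" using r by (intro order_tendstoD(1)) auto
  then obtain N where N: "\<And>t. t \<ge> N \<Longrightarrow> 1 < r t" by (auto simp: eventually_sequentially)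
  have "incseq (\<lambda>t. x (t + N))"
  proof (rule incseq_SucI)
    fix t
    have "x (t + N) * 1 \<le> x (t + N) * r (t + N)"
      using N[of "t + N"] pos[of "t + N"] by (intro mult_left_mono) auto
    then show "x (t + N) \<le> x (Suc t + N)" by (simp add: step)
  qed
  then have "x (0 + N) \<le> a"
    by (rule incseq_le) (rule LIMSEQ_ignore_initial_segment[OF x])
  then have "0 < a" using pos[of N] by simp
  have "a * \<rho> = a" by (rule ratio_times_limit[OF step x r])
  with \<open>0 < a\<close> \<open>\<not> \<rho> \<le> 1\<close> show False by simp
qed

section \<open>The update as a marginal and a conditional of the split mass\<close>

definition split_mass ::
  "real ^ 'n::finite ^ 'm::finite \<Rightarrow> ('m, 'n, 'k::finite) fpair \<Rightarrow> 'm \<Rightarrow> 'k \<Rightarrow> 'n \<Rightarrow> real" where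
  "split_mass P Q i l j =
     fst Q $ i $ l * snd Q $ l $ j * P $ i $ j / (fst Q ** snd Q) $ i $ j"

lemma alg_step_fst: "fst (alg_step P Q) $ i $ l = (\<Sum>j\<in>UNIV. split_mass P Q i l j)"
  by (cases Q) (simp add: alg_step_def split_mass_def sum_distrib_left mult.assoc)

lemma alg_step_snd:
  "snd (alg_step P Q) $ l $ j =
     (\<Sum>i\<in>UNIV. split_mass P Q i l j) / (\<Sum>i\<in>UNIV. \<Sum>j\<in>UNIV. split_mass P Q i l j)"
  by (cases Q) (simp add: alg_step_def split_mass_def sum_distrib_left mult_ac)

text \<open>Positivity of all entries is not invariant: a zero row of \<open>P\<close> annihilates a row of \<open>Q\<^sub>-\<close>,
  a zero column a column of \<open>Q\<^sub>+\<close>.\<close>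

definition feasible ::
  "real ^ 'n::finite ^ 'm::finite \<Rightarrow> ('m, 'n, 'k::finite) fpair \<Rightarrow> bool" where
  "feasible P Q \<longleftrightarrow> Q \<in> nn_domain \<and>
     (\<forall>i j l. P $ i $ j \<noteq> 0 \<longrightarrow> 0 < fst Q $ i $ l \<and> 0 < snd Q $ l $ j)"

section \<open>One-step estimates for feasible pairs\<close>

context
  fixes P :: "real ^ 'n::finite ^ 'm::finite"
  assumes P: "prob_matrix P"
begin

lemma P_nonneg: "0 \<le> P $ i $ j"
  using P by (simp add: prob_matrix_def)

lemma nn_domain_nonneg:
  assumes "Q \<in> nn_domain"
  shows "0 \<le> fst Q $ i $ l" "0 \<le> snd Q $ l $ j" "0 \<le> (fst Q ** snd Q) $ i $ j"
  using assms by (auto simp: nn_domain_def matrix_matrix_mult_def intro!: sum_nonneg)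

lemma split_mass_nonneg:
  assumes "Q \<in> nn_domain" shows "0 \<le> split_mass P Q i l j"
  unfolding split_mass_def
  by (intro divide_nonneg_nonneg mult_nonneg_nonneg nn_domain_nonneg[OF assms] P_nonneg)

lemma feasible_product_pos:
  assumes Q: "feasible P Q" and ij: "P $ i $ j \<noteq> 0"
  shows "0 < (fst Q ** snd Q) $ i $ j"
  using assms unfolding matrix_matrix_mult_def feasible_def by (auto intro!: sum_pos)

lemma split_mass_pos:
  assumes Q: "feasible P Q" and ij: "P $ i $ j \<noteq> 0"
  shows "0 < split_mass P Q i l j"
proof -
  have "0 < P $ i $ j" using P_nonneg[of i j] ij by simp
  then show ?thesis
    using Q ij feasible_product_pos[OF Q ij] unfolding split_mass_def feasible_def
    by (intro divide_pos_pos mult_pos_pos) blast+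
qed

lemma sum_split_mass:
  assumes Q: "feasible P Q"
  shows "(\<Sum>l\<in>UNIV. split_mass P Q i l j) = P $ i $ j"
proof (cases "P $ i $ j = 0")
  case False
  have "(\<Sum>l\<in>UNIV. split_mass P Q i l j) =
      (fst Q ** snd Q) $ i $ j * (P $ i $ j / (fst Q ** snd Q) $ i $ j)"
    unfolding split_mass_def
    by (simp add: matrix_matrix_mult_def sum_distrib_right sum_divide_distrib)
  then show ?thesis using feasible_product_pos[OF Q False] by simp
qed (simp add: split_mass_def)

text \<open>This mass is the denominator in the update of \<open>Q\<^sub>+\<close>. Since
  \<open>P\<close> has total mass 1, some entry is nonzero, and feasibility gives every hidden index
  a positive share of it.\<close>

lemma sum_split_mass_pos:
  assumes Q: "feasible P Q"
  shows "0 < (\<Sum>i\<in>UNIV. \<Sum>j\<in>UNIV. split_mass P Q i l j)"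
proof -
  have nn: "0 \<le> split_mass P Q i l j" for i j
    using Q split_mass_nonneg unfolding feasible_def by blast
  obtain i j where ij: "P $ i $ j \<noteq> 0"
  proof (rule ccontr)
    assume "\<not> thesis"
    then have "\<And>i j. P $ i $ j = 0" using that by blast
    then show False using P by (simp add: prob_matrix_def)
  qed
  have "0 < (\<Sum>j\<in>UNIV. split_mass P Q i l j)"
    using nn split_mass_pos[OF Q ij] by (intro sum_pos2[of _ j]) auto
  then show ?thesis using nn by (intro sum_pos2[of _ i]) (auto intro: sum_nonneg)
qed

text \<open>A single share never exceeds \<open>P(ij)\<close>. Hence normalizing by this mass can
  only enlarge the entries of \<open>Q\<^sub>+\<close>.\<close>

lemma sum_split_mass_le_one:
  assumes Q: "feasible P Q"
  shows "(\<Sum>i\<in>UNIV. \<Sum>j\<in>UNIV. split_mass P Q i l j) \<le> 1"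
proof -
  have nn: "0 \<le> split_mass P Q i l j" for i l j
    using Q split_mass_nonneg unfolding feasible_def by blast
  have "split_mass P Q i l j \<le> P $ i $ j" for i j
    unfolding sum_split_mass[OF Q, symmetric] using nn by (intro member_le_sum) auto
  then have "(\<Sum>i\<in>UNIV. \<Sum>j\<in>UNIV. split_mass P Q i l j) \<le> (\<Sum>i\<in>UNIV. \<Sum>j\<in>UNIV. P $ i $ j)"
    by (intro sum_mono) auto
  then show ?thesis using P by (simp add: prob_matrix_def)
qed

lemma split_mass_le_step:
  assumes Q: "feasible P Q"
  shows "split_mass P Q i l j \<le> fst (alg_step P Q) $ i $ l"
    and "split_mass P Q i l j \<le> snd (alg_step P Q) $ l $ j"
proof -
  have nn: "0 \<le> split_mass P Q i l j" for i l j
    using Q split_mass_nonneg unfolding feasible_def by blast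
  show "split_mass P Q i l j \<le> fst (alg_step P Q) $ i $ l"
    unfolding alg_step_fst using nn by (intro member_le_sum) auto
  \<comment> \<open>The trivial denominator 1 lets the next step compare denominators.\<close>
  have "split_mass P Q i l j \<le> (\<Sum>i\<in>UNIV. split_mass P Q i l j) / 1"
    using nn member_le_sum[of i UNIV "\<lambda>i. split_mass P Q i l j"] by simp
  also have "\<dots> \<le> snd (alg_step P Q) $ l $ j"
    unfolding alg_step_snd using sum_split_mass_le_one[OF Q] sum_split_mass_pos[OF Q] nn
    by (intro divide_left_mono sum_nonneg) auto
  finally show "split_mass P Q i l j \<le> snd (alg_step P Q) $ l $ j" .
qed

text \<open>Both nonnegativity and the required positivity are inherited from the split mass, which
  lies below the new entries.\<close>

lemma alg_step_feasible:
  assumes Q: "feasible P Q"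
  shows "feasible P (alg_step P Q)"
proof -
  have nn: "0 \<le> split_mass P Q i l j" for i l j
    using Q split_mass_nonneg unfolding feasible_def by blast
  have "0 \<le> fst (alg_step P Q) $ i $ l" "0 \<le> snd (alg_step P Q) $ l $ j" for i l j
    using nn split_mass_le_step[OF Q] order_trans by blast+
  then have "alg_step P Q \<in> nn_domain" by (auto simp: nn_domain_def mem_Times_iff)
  then show ?thesis
    unfolding feasible_def
    using split_mass_pos[OF Q] split_mass_le_step[OF Q] less_le_trans by blast
qed

lemma alg_step_row_sum:
  assumes Q: "feasible P Q"
  shows "(\<Sum>j\<in>UNIV. snd (alg_step P Q) $ l $ j) = 1"
proof -
  have "(\<Sum>j\<in>UNIV. \<Sum>i\<in>UNIV. split_mass P Q i l j) = (\<Sum>i\<in>UNIV. \<Sum>j\<in>UNIV. split_mass P Q i l j)"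
    by (rule sum.swap)
  then show ?thesis
    unfolding alg_step_snd using sum_split_mass_pos[OF Q, of l]
    by (simp flip: sum_divide_distrib)
qed

lemma alg_step_product_ge:
  fixes Q :: "('m, 'n, 'k::finite) fpair"
  assumes Q: "feasible P Q"
  shows "(P $ i $ j)\<^sup>2 / CARD('k) \<le> (fst (alg_step P Q) ** snd (alg_step P Q)) $ i $ j"
proof -
  have nn: "0 \<le> split_mass P Q i l j" for l
    using Q split_mass_nonneg unfolding feasible_def by blast
  \<comment> \<open>Cauchy-Schwarz against the constant vector; the shares of the hidden indices add
    up to \<open>P(ij)\<close>.\<close>
  have "(P $ i $ j)\<^sup>2 \<le> (\<Sum>l\<in>UNIV. (split_mass P Q i l j)\<^sup>2) * CARD('k)"
    using sum_squared_le_sum_of_squares[of "\<lambda>l. split_mass P Q i l j" UNIV] sum_split_mass[OF Q]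
    by simp
  then have "(P $ i $ j)\<^sup>2 / CARD('k) \<le> (\<Sum>l\<in>UNIV. (split_mass P Q i l j)\<^sup>2)"
    by (simp add: divide_le_eq)
  also have "\<dots> \<le> (fst (alg_step P Q) ** snd (alg_step P Q)) $ i $ j"
    unfolding matrix_matrix_mult_def power2_eq_square
    using nn order_trans[OF nn split_mass_le_step(1)[OF Q]]
    by (auto intro!: sum_mono mult_mono split_mass_le_step[OF Q])
  finally show ?thesis .
qed

section \<open>Passage to the limit\<close>

lemma alg_limit_product_pos:
  fixes Qm :: "real ^ 'k::finite ^ 'm"
  assumes S: "\<And>t. S (Suc t) = alg_step P (S t)" and feas: "\<And>t. feasible P (S t)"
    and lim: "S \<longlonglongrightarrow> (Qm, Qp)" and ij: "P $ i $ j \<noteq> 0"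
  shows "0 < (Qm ** Qp) $ i $ j"
proof -
  have "(\<lambda>t. (fst (S t) ** snd (S t)) $ i $ j) \<longlonglongrightarrow> (Qm ** Qp) $ i $ j"
    using tendsto_fst[OF lim] tendsto_snd[OF lim]
    unfolding matrix_matrix_mult_def by (auto intro!: tendsto_intros)
  \<comment> \<open>The lower bound concerns outputs of a step, so the sequence is shifted by
    one.\<close>
  then have "(\<lambda>t. (fst (S (Suc t)) ** snd (S (Suc t))) $ i $ j) \<longlonglongrightarrow> (Qm ** Qp) $ i $ j"
    by (rule LIMSEQ_Suc)
  then have "(P $ i $ j)\<^sup>2 / CARD('k) \<le> (Qm ** Qp) $ i $ j"
    using alg_step_product_ge[OF feas] S by (intro LIMSEQ_le_const) auto
  moreover have "0 < (P $ i $ j)\<^sup>2 / CARD('k)" using ij by simp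
  ultimately show ?thesis by linarith
qed

text \<open>These are Kuhn-Tucker conditions: the product equation is complementary slackness and
  makes the derivative vanish at positive entries. Column positivity enters through the factors of
  \<open>Q\<^sub>+\<close>, whose denominators converge to the column sums of
  \<open>Qm\<close>.\<close>

lemma alg_limit_partials:
  fixes Qm :: "real ^ 'k::finite ^ 'm" and Qp :: "real ^ 'n ^ 'k"
  assumes S: "\<And>t. S (Suc t) = alg_step P (S t)" and feas: "\<And>t. feasible P (S t)"
    and lim: "S \<longlonglongrightarrow> (Qm, Qp)" and col: "\<And>l. 0 < (\<Sum>i\<in>UNIV. Qm $ i $ l)"
  shows "\<exists>d\<ge>0. Qm $ i $ l * d = 0 \<and> has_partial_minus P (Qm, Qp) i l d"
    and "\<exists>d\<ge>0. Qp $ l $ j * d = 0 \<and> has_partial_plus P (Qm, Qp) l j d"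
proof -
  define R where "R = Qm ** Qp"
  define T where "T t = fst (S t) ** snd (S t)" for t
  have limm: "(\<lambda>t. fst (S t) $ i $ l) \<longlonglongrightarrow> Qm $ i $ l" for i l
    using tendsto_fst[OF lim] by (auto intro: tendsto_intros)
  have limp: "(\<lambda>t. snd (S t) $ l $ j) \<longlonglongrightarrow> Qp $ l $ j" for l j
    using tendsto_snd[OF lim] by (auto intro: tendsto_intros)
  have Rpos: "0 < R $ i $ j" if "P $ i $ j \<noteq> 0" for i j
    unfolding R_def by (rule alg_limit_product_pos[OF S feas lim that])
  \<comment> \<open>Where \<open>P(ij) = 0\<close> the quotient is constantly 0, even if the product
    tends to 0; elsewhere the limiting product is positive.\<close>
  have limT: "(\<lambda>t. P $ i $ j / T t $ i $ j) \<longlonglongrightarrow> P $ i $ j / R $ i $ j" for i j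
  proof (cases "P $ i $ j = 0")
    case False
    have "(\<lambda>t. T t $ i $ j) \<longlonglongrightarrow> R $ i $ j"
      unfolding T_def R_def matrix_matrix_mult_def by (auto intro!: tendsto_intros limm limp)
    then show ?thesis using Rpos[OF False] by (intro tendsto_divide) auto
  qed simp
  have nn: "S t \<in> nn_domain" for t using feas unfolding feasible_def by blast
  have Qnn: "(Qm, Qp) \<in> nn_domain"
    unfolding nn_domain_def
    by (auto intro!: LIMSEQ_le_const[OF limm] LIMSEQ_le_const[OF limp] nn_domain_nonneg[OF nn])
  have fin: "\<bar>objective P (Qm, Qp)\<bar> \<noteq> \<infinity>"
    unfolding objective_finite_iff R_def[symmetric] by (auto dest: Rpos)
  \<comment> \<open>Feasibility does not include normalization, so row sums are taken after a
    step.\<close>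
  have row: "(\<Sum>j\<in>UNIV. Qp $ l $ j) = 1" for l
  proof (rule LIMSEQ_unique)
    show "(\<lambda>t. \<Sum>j\<in>UNIV. snd (S (Suc t)) $ l $ j) \<longlonglongrightarrow> (\<Sum>j\<in>UNIV. Qp $ l $ j)"
      by (intro tendsto_sum LIMSEQ_Suc limp)
    show "(\<lambda>t. \<Sum>j\<in>UNIV. snd (S (Suc t)) $ l $ j) \<longlonglongrightarrow> 1"
      by (simp add: S alg_step_row_sum[OF feas])
  qed
  show "\<exists>d\<ge>0. Qm $ i $ l * d = 0 \<and> has_partial_minus P (Qm, Qp) i l d"
  proof -
    \<comment> \<open>\<open>?r\<close> is the limit of the update factor; by the unit row sums of
      \<open>Qp\<close> the partial derivative is \<open>1 - ?r\<close>.\<close>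
    let ?r = "\<Sum>j\<in>UNIV. Qp $ l $ j * (P $ i $ j / R $ i $ j)"
    let ?rt = "\<lambda>t. \<Sum>j\<in>UNIV. snd (S t) $ l $ j * (P $ i $ j / T t $ i $ j)"
    have rt: "?rt \<longlonglongrightarrow> ?r" by (intro tendsto_sum tendsto_mult limp limT)
    have step: "fst (S (Suc t)) $ i $ l = fst (S t) $ i $ l * ?rt t" for t
      unfolding S alg_step_fst split_mass_def T_def by (simp add: sum_distrib_left mult.assoc)
    have "?r \<le> 1"
    \<comment> \<open>A zero row of \<open>P\<close> makes the entry vanish after one step, so the
      monotonicity argument fails, but then \<open>?r = 0\<close>.\<close>
    proof (cases "\<exists>j. P $ i $ j \<noteq> 0")
      case True
      then have "0 < fst (S t) $ i $ l" for t using feas unfolding feasible_def by blast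
      then show ?thesis by (rule convergent_limit_ratio_le_one[OF step _ limm rt])
    qed simp
    moreover have "Qm $ i $ l * ?r = Qm $ i $ l" by (rule ratio_times_limit[OF step limm rt])
    moreover have "(\<Sum>j\<in>UNIV. Qp $ l $ j * (1 - P $ i $ j / R $ i $ j)) = 1 - ?r"
      by (simp add: right_diff_distrib sum_subtractf row)
    ultimately show ?thesis
      using has_partial_minus_formula[OF P_nonneg Qnn fin, of i l]
      by (intro exI[of _ "1 - ?r"]) (simp add: R_def right_diff_distrib)
  qed
  show "\<exists>d\<ge>0. Qp $ l $ j * d = 0 \<and> has_partial_plus P (Qm, Qp) l j d"
  proof -
    let ?C = "\<Sum>i\<in>UNIV. Qm $ i $ l"
    let ?h = "\<Sum>i\<in>UNIV. Qm $ i $ l * (P $ i $ j / R $ i $ j)"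
    \<comment> \<open>The normalizing mass of index \<open>l\<close> is the column sum of the next
      \<open>Q\<^sub>-\<close>, with limit \<open>?C\<close>. The partial derivative is
      \<open>?C - ?h\<close>, that is, \<open>?C\<close> times 1 minus the limiting factor.\<close>
    let ?rt = "\<lambda>t. (\<Sum>i\<in>UNIV. fst (S t) $ i $ l * (P $ i $ j / T t $ i $ j))
                     / (\<Sum>i\<in>UNIV. fst (S (Suc t)) $ i $ l)"
    have C: "0 < ?C" by (rule col)
    have rt: "?rt \<longlonglongrightarrow> ?h / ?C"
      by (intro tendsto_divide tendsto_sum tendsto_mult limm limT LIMSEQ_Suc[OF limm])
         (rule less_imp_neq[OF C, symmetric])
    have step: "snd (S (Suc t)) $ l $ j = snd (S t) $ l $ j * ?rt t" for t
      unfolding S alg_step_snd alg_step_fst unfolding split_mass_def T_def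
      by (simp add: sum_distrib_left mult_ac)
    have "?h / ?C \<le> 1"
    proof (cases "\<exists>i. P $ i $ j \<noteq> 0")
      case True
      then have "0 < snd (S t) $ l $ j" for t using feas unfolding feasible_def by blast
      then show ?thesis by (rule convergent_limit_ratio_le_one[OF step _ limp rt])
    qed simp
    then have "0 \<le> ?C - ?h" using C by (simp add: divide_le_eq)
    moreover have "Qp $ l $ j * (?h / ?C) = Qp $ l $ j" by (rule ratio_times_limit[OF step limp rt])
    then have "Qp $ l $ j * (?C - ?h) = 0" using C by (auto simp: field_simps)
    moreover have "(\<Sum>i\<in>UNIV. Qm $ i $ l * (1 - P $ i $ j / R $ i $ j)) = ?C - ?h"
      by (simp add: right_diff_distrib sum_subtractf)
    ultimately show ?thesis
      using has_partial_plus_formula[OF P_nonneg Qnn fin, of l j]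
      by (intro exI[of _ "?C - ?h"]) (simp add: R_def)
  qed
qed

end

theorem theorem6p3:
  fixes P :: "real ^ 'n::finite ^ 'm::finite"
    and Qm :: "real ^ 'k::finite ^ 'm" and Qp :: "real ^ 'n ^ 'k"
  assumes "prob_matrix P"
    and "CARD('k) \<le> min CARD('m) CARD('n)"
    and "alg_limit_point P (Qm, Qp)"
  shows "((Qm, Qp) \<in> domain_interior \<longrightarrow> stationary_point P (Qm, Qp)) \<and>
         ((Qm, Qp) \<in> domain_boundary \<and> (\<forall>l. 0 < (\<Sum>i\<in>UNIV. Qm $ i $ l)) \<longrightarrow>
            partials_nonneg P (Qm, Qp))"
proof -
  obtain Q0 where Q0: "admissible_init Q0" and lim: "(\<lambda>t. (alg_step P ^^ t) Q0) \<longlonglongrightarrow> (Qm, Qp)"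
    using assms(3) unfolding alg_limit_point_def by blast
  have feas: "feasible P ((alg_step P ^^ t) Q0)" for t
  proof (induction t)
    case 0
    show ?case using Q0
      by (cases Q0) (auto simp: feasible_def admissible_init_def nn_domain_def domain_interior_def
          intro: less_imp_le)
  next
    case (Suc t)
    then show ?case by (simp add: alg_step_feasible[OF assms(1)])
  qed
  \<comment> \<open>Simplification discharges the recurrence premise by unfolding the
    iterate.\<close>
  note partials = alg_limit_partials[OF assms(1) _ feas lim, simplified]
  show ?thesis
  proof (intro conjI impI)
    assume "(Qm, Qp) \<in> domain_interior"
    then have pos: "0 < Qm $ i $ l" "0 < Qp $ l $ j" for i l j by (auto simp: domain_interior_def)
    \<comment> \<open>Interior pairs have positive column sums, so the same conditions apply, and
      slackness turns each derivative into 0.\<close>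
    have col: "0 < (\<Sum>i\<in>UNIV. Qm $ i $ l)" for l by (intro sum_pos pos) auto
    have "has_partial_minus P (Qm, Qp) i l 0" "has_partial_plus P (Qm, Qp) l j 0" for i l j
      using partials(1)[OF col, of i l] partials(2)[OF col, of l j] pos(1)[of i l] pos(2)[of l j]
      by auto
    then show "stationary_point P (Qm, Qp)" by (simp add: stationary_point_def)
  next
    assume "(Qm, Qp) \<in> domain_boundary \<and> (\<forall>l. 0 < (\<Sum>i\<in>UNIV. Qm $ i $ l))"
    then have col: "0 < (\<Sum>i\<in>UNIV. Qm $ i $ l)" for l by blast
    show "partials_nonneg P (Qm, Qp)"
      unfolding partials_nonneg_def using partials(1)[OF col] partials(2)[OF col] by blast
  qed
qed

end
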